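(* Let $H$ be an $m$-uniform connected hypergraph ($m\ge2$, with at least one edge) on $n$ vertices, with an associated dual tensor $\mathcal{A}=\mathcal{A}_s+\mathcal{A}_d\epsilon$ of order $m$ and dimension $n$, where $\mathcal{A}_s$ is the adjacency tensor of $H$. Let $x=x_s+x_d\epsilon$ be the centrality vector of $H$, with associated positive dual eigenvalue $\lambda=\lambda_s+\lambda_d\epsilon$ of $\mathcal{A}$. If $(x_s)_i=(x_s)_j$ for two vertices $i$ and $j$, then $$(x_d)_i-(x_d)_j=(e_i^\top-e_j^\top)M(H,x_s)^\#(\mathcal{A}_d-\lambda_d\mathcal{I})x_s^{m-1}=(e_i^\top-e_j^\top)M^{(1)}(\mathcal{A}_d-\lambda_d\mathcal{I})x_s^{m-1}$$ for any $\{1\}$-inverse $M^{(1)}$ of $M(H,x_s)$.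
   Context: Dual numbers: $\mathbb{D}=\{a_s+a_d\epsilon: a_s,a_d\in\mathbb{R}\}$ with $\epsilon\ne0$, $\epsilon^2=0$, $\epsilon$ commuting with reals; $a_s,a_d$ are the standard and dual parts. A dual vector is $x=x_s+x_d\epsilon$ with $x_s,x_d\in\mathbb{R}^n$; a dual tensor of order $m$ and dimension $n$ is $\mathcal{A}=\mathcal{A}_s+\mathcal{A}_d\epsilon$ with $\mathcal{A}_s,\mathcal{A}_d$ real $n\times\cdots\times n$ ($m$ indices) arrays. A dual number $\lambda$ is positive if $\lambda_s>0$; a dual vector $x$ is positive if all entries of $x_s$ are positive. For a (real or dual) tensor $\mathcal{A}=(a_{i_1\cdots i_m})$ and vector $x$, $\mathcal{A}x^{m-1}$ is the vector with $i$-th entry $\sum_{i_2,\ldots,i_m=1}^n a_{ii_2\cdots i_m}x_{i_2}\cdots x_{i_m}$, and $x^{[m-1]}=(x_1^{m-1},\ldots,x_n^{m-1})^\top$. A dual number $\lambda$ is an eigenvalue of the dual tensor $\mathcal{A}$ with eigenvector $x=x_s+x_d\epsilon\in\mathbb{D}^n$ if $x_s\neq0$ and $\mathcal{A}x^{m-1}=\lambda x^{[m-1]}$. $\mathcal{I}$ is the diagonal tensor of order $m$ and dimension $n$ with all diagonal entries $1$ (so $\mathcal{I}x^{m-1}=x^{[m-1]}$). In an $m$-uniform hypergraph $H$ with vertex set $\{1,\ldots,n\}$, every edge is a set of $m$ distinct vertices. Its adjacency tensor has entries $a_{i_1\cdots i_m}=\frac{1}{(m-1)!}$ if $\{i_1,\ldots,i_m\}\in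 E(H)$ and $0$ otherwise. The centrality vector of $H$ (relative to $\mathcal{A}_d$) is the unique positive dual eigenvector $x=x_s+x_d\epsilon$ of $\mathcal{A}$, associated with a positive dual eigenvalue $\lambda=\lambda_s+\lambda_d\epsilon$, such that $x_s^\top x_d=0$ and $\|x_s\|_m=1$, where $\|x_s\|_m=(\sum_i |(x_s)_i|^m)^{1/m}$; here $\lambda_s$ is the spectral radius of $\mathcal{A}_s$. For a vertex subset $U$, $x_s^U=\prod_{i\in U}(x_s)_i$ (empty product $=1$). $M(H,x_s)$ is the $n\times n$ symmetric matrix with entries $$(M(H,x_s))_{uv}=\begin{cases}(m-1)\lambda_s(x_s)_u^{m-2}&\text{if }u=v,\\ -\sum_{\{u,v\}\subseteq e\in E(H)}x_s^{e\setminus\{u,v\}}&\text{if }u\sim v,\\ 0&\text{otherwise,}\end{cases}$$ where $u\sim v$ means that some edge contains the two distinct vertices $u$ and $v$. $e_i$ is the $i$-th standard unit column vector. A $\{1\}$-inverse of $M$ is any real matrix $X$ with $MXM=M$. The group inverse $M^\#$ is the unique matrix $X$ with $MXM=M$, $XMX=X$, $MX=XM$ (it exists iff ${\rm rank}(M)={\rm rank}(M^2)$). *)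

theory Defs
  imports "HOL-Analysis.Analysis"
begin

section \<open>Dual numbers\<close>

datatype dual = Dual (std: real) (dul: real)

instantiation dual :: comm_ring_1
begin

definition zero_dual :: dual where "0 = Dual 0 0"
definition one_dual :: dual where "1 = Dual 1 0"
definition plus_dual :: "dual \<Rightarrow> dual \<Rightarrow> dual"
  where "a + b = Dual (std a + std b) (dul a + dul b)"
definition uminus_dual :: "dual \<Rightarrow> dual"
  where "- a = Dual (- std a) (- dul a)"
definition minus_dual :: "dual \<Rightarrow> dual \<Rightarrow> dual"
  where "a - b = Dual (std a - std b) (dul a - dul b)"
definition times_dual :: "dual \<Rightarrow> dual \<Rightarrow> dual"
  where "a * b = Dual (std a * std b) (std a * dul b + dul a * std b)"

instance
  by standard
    (auto simp: zero_dual_def one_dual_def plus_dual_def uminus_dual_def minus_dual_def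
      times_dual_def algebra_simps intro: dual.expand)

end

definition dual_eps :: dual where "dual_eps = Dual 0 1"

lemma dual_eps_nonzero: "dual_eps \<noteq> 0"
  by (simp add: dual_eps_def zero_dual_def)

lemma dual_eps_square: "dual_eps ^ 2 = 0"
  by (simp add: dual_eps_def zero_dual_def times_dual_def power2_eq_square)

lemma dual_decomp: "a = Dual (std a) 0 + Dual (dul a) 0 * dual_eps"
  by (simp add: dual_eps_def plus_dual_def times_dual_def)

definition vstd :: "dual ^ 'n \<Rightarrow> real ^ 'n" where "vstd x = (\<chi> i. std (x $ i))"
definition vdul :: "dual ^ 'n \<Rightarrow> real ^ 'n" where "vdul x = (\<chi> i. dul (x $ i))"

definition dual_positive :: "dual \<Rightarrow> bool" where "dual_positive a \<longleftrightarrow> std a > 0"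

definition dual_vec_positive :: "dual ^ 'n \<Rightarrow> bool"
  where "dual_vec_positive x \<longleftrightarrow> (\<forall>i. vstd x $ i > 0)"


section \<open>Tensors\<close>

text \<open>A tensor of order \<open>m\<close> whose indices range over \<open>'n\<close> is a function on index lists;
  only its values on lists of length \<open>m\<close> are meaningful.\<close>

type_synonym ('a, 'n) tensor = "'n list \<Rightarrow> 'a"

definition tensor_apply ::
  "nat \<Rightarrow> ('a::comm_ring_1, 'n::finite) tensor \<Rightarrow> 'a ^ 'n \<Rightarrow> 'a ^ 'n"
  where "tensor_apply m A x =
    (\<chi> i. \<Sum>js | length js = m - 1. A (i # js) * (\<Prod>j\<leftarrow>js. x $ j))"

definition vec_power :: "'a::comm_ring_1 ^ 'n \<Rightarrow> nat \<Rightarrow> 'a ^ 'n"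
  where "vec_power x k = (\<chi> i. x $ i ^ k)"

definition unit_tensor :: "nat \<Rightarrow> ('a::comm_ring_1, 'n::finite) tensor"
  where "unit_tensor m is = (if \<exists>i. is = replicate m i then 1 else 0)"

lemma unit_tensor_apply:
  assumes "m \<ge> 1"
  shows "tensor_apply m (unit_tensor m) x = vec_power x (m - 1)"
proof -
  have "(\<Sum>js | length js = m - 1. unit_tensor m (i # js) * (\<Prod>j\<leftarrow>js. x $ j)) = x $ i ^ (m - 1)"
    for i
  proof -
    have fin: "finite {js :: 'b list. length js = m - 1}"
      using finite_lists_length_eq[of "UNIV :: 'b set" "m - 1"] by simp
    have ut: "unit_tensor m (i # js) = (if js = replicate (m - 1) i then 1 else (0::'a))" for js
      using assms by (cases m) (auto simp: unit_tensor_def)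
    have "(\<Sum>js | length js = m - 1. unit_tensor m (i # js) * (\<Prod>j\<leftarrow>js. x $ j)) =
        (\<Sum>js | length js = m - 1. if js = replicate (m - 1) i then (\<Prod>j\<leftarrow>js. x $ j) else 0)"
      by (intro sum.cong) (auto simp: ut)
    also have "\<dots> = x $ i ^ (m - 1)"
      using fin by (simp add: prod_list_replicate)
    finally show ?thesis .
  qed
  then show ?thesis by (simp add: tensor_apply_def vec_power_def)
qed

definition dual_eigenpair :: "nat \<Rightarrow> (dual, 'n::finite) tensor \<Rightarrow> dual \<Rightarrow> dual ^ 'n \<Rightarrow> bool"
  where "dual_eigenpair m A l x \<longleftrightarrow>
    vstd x \<noteq> 0 \<and> tensor_apply m A x = (\<chi> i. l * vec_power x (m - 1) $ i)"

definition tensor_spectral_radius :: "nat \<Rightarrow> (real, 'n::finite) tensor \<Rightarrow> real"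
  where "tensor_spectral_radius m A =
    Sup {cmod \<mu> | \<mu> y. y \<noteq> 0 \<and>
      tensor_apply m (\<lambda>is. complex_of_real (A is)) y = (\<chi> i. \<mu> * vec_power y (m - 1) $ i)}"


section \<open>Uniform hypergraphs\<close>

text \<open>The vertex set is the whole finite type \<open>'n\<close>, so a hypergraph is given by its edge set.\<close>

definition uniform_hypergraph :: "nat \<Rightarrow> 'n::finite set set \<Rightarrow> bool"
  where "uniform_hypergraph m E \<longleftrightarrow> (\<forall>e\<in>E. card e = m)"

definition hyper_adj :: "'n set set \<Rightarrow> 'n \<Rightarrow> 'n \<Rightarrow> bool"
  where "hyper_adj E u v \<longleftrightarrow> u \<noteq> v \<and> (\<exists>e\<in>E. {u, v} \<subseteq> e)"

definition hyper_connected :: "'n set set \<Rightarrow> bool"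
  where "hyper_connected E \<longleftrightarrow> (\<forall>u v. (hyper_adj E)\<^sup>*\<^sup>* u v)"

definition adjacency_tensor :: "nat \<Rightarrow> 'n set set \<Rightarrow> (real, 'n) tensor"
  where "adjacency_tensor m E is = (if set is \<in> E then 1 / fact (m - 1) else 0)"

definition vec_pnorm :: "nat \<Rightarrow> real ^ 'n \<Rightarrow> real"
  where "vec_pnorm p x = (\<Sum>i\<in>UNIV. \<bar>x $ i\<bar> ^ p) powr (1 / real p)"

text \<open>When the standard part of \<open>A\<close> is the adjacency tensor of a connected uniform hypergraph,
  these conditions have exactly one solution \<open>(l, x)\<close>, the centrality vector and its eigenvalue.
  That \<open>std l\<close> is then the spectral radius of the standard part need not be required: see
  \<open>centrality_spectral_radius\<close> below.\<close>

definition is_centrality_vector ::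
  "nat \<Rightarrow> (dual, 'n::finite) tensor \<Rightarrow> dual \<Rightarrow> dual ^ 'n \<Rightarrow> bool"
  where "is_centrality_vector m A l x \<longleftrightarrow>
    dual_eigenpair m A l x \<and> dual_positive l \<and> dual_vec_positive x \<and>
    vstd x \<bullet> vdul x = 0 \<and> vec_pnorm m (vstd x) = 1"

definition centrality_matrix ::
  "nat \<Rightarrow> 'n::finite set set \<Rightarrow> real \<Rightarrow> real ^ 'n \<Rightarrow> real ^ 'n ^ 'n"
  where "centrality_matrix m E ls xs = (\<chi> u v.
    if u = v then real (m - 1) * ls * xs $ u ^ (m - 2)
    else if hyper_adj E u v then
      - (\<Sum>e | e \<in> E \<and> {u, v} \<subseteq> e. \<Prod>k\<in>e - {u, v}. xs $ k)
    else 0)"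


section \<open>Generalized inverses\<close>

definition is_one_inverse :: "real ^ 'n ^ 'n \<Rightarrow> real ^ 'n ^ 'n \<Rightarrow> bool"
  where "is_one_inverse M X \<longleftrightarrow> M ** X ** M = M"

definition is_group_inverse :: "real ^ 'n ^ 'n \<Rightarrow> real ^ 'n ^ 'n \<Rightarrow> bool"
  where "is_group_inverse M X \<longleftrightarrow> M ** X ** M = M \<and> X ** M ** X = X \<and> M ** X = X ** M"

definition group_inverse :: "real ^ 'n ^ 'n \<Rightarrow> real ^ 'n ^ 'n"
  where "group_inverse M = (THE X. is_group_inverse M X)"

lemma group_inverse_eqI:
  assumes X: "is_group_inverse M X"
  shows "group_inverse M = X"
proof -
  have "Y = X" if Y: "is_group_inverse M Y" for Y
  proof -
    have "M ** Y = M ** X ** (M ** Y)"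
      using X by (metis is_group_inverse_def matrix_mul_assoc)
    also have "\<dots> = X ** (M ** Y ** M)"
      using X Y by (metis is_group_inverse_def matrix_mul_assoc)
    also have "\<dots> = M ** X"
      using X Y by (metis is_group_inverse_def)
    finally have MY: "M ** Y = M ** X" .
    have "Y = Y ** M ** Y" using Y by (metis is_group_inverse_def)
    also have "\<dots> = X ** M ** Y" using X Y MY by (metis is_group_inverse_def)
    also have "\<dots> = X ** M ** X" using MY by (metis matrix_mul_assoc)
    also have "\<dots> = X" using X by (metis is_group_inverse_def)
    finally show ?thesis .
  qed
  with X show ?thesis unfolding group_inverse_def by (rule the_equality)
qed


section \<open>The standard part of the eigenvalue is the spectral radius\<close>

lemma std_dual_simps [simp]:
  "std 0 = 0" "std 1 = 1" "std (a + b) = std a + std b" "std (a * b) = std a * std b"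
  by (simp_all add: zero_dual_def one_dual_def plus_dual_def times_dual_def)

lemma std_sum: "std (sum f S) = (\<Sum>i\<in>S. std (f i))"
  by (induction S rule: infinite_finite_induct) auto

lemma std_prod_list: "std (\<Prod>j\<leftarrow>js. f j) = (\<Prod>j\<leftarrow>js. std (f j))"
  by (induction js) auto

lemma std_power: "std (a ^ k) = std a ^ k"
  by (induction k) auto

lemma cmod_prod_list: "cmod (\<Prod>j\<leftarrow>js. f j) = (\<Prod>j\<leftarrow>js. cmod (f j))"
  by (induction js) (auto simp: norm_mult)

lemma of_real_prod_list: "(\<Prod>j\<leftarrow>js. complex_of_real (f j)) = of_real (\<Prod>j\<leftarrow>js. f j)"
  by (induction js) auto

lemma prod_list_le_scaled:
  assumes "\<And>j. 0 \<le> f j" "\<And>j. f j \<le> t * g j"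
  shows "0 \<le> (\<Prod>j\<leftarrow>js. f j) \<and> (\<Prod>j\<leftarrow>js. f j) \<le> t ^ length js * (\<Prod>j\<leftarrow>js. g j :: real)"
proof (induction js)
  case (Cons a js)
  have "f a * (\<Prod>j\<leftarrow>js. f j) \<le> (t * g a) * (t ^ length js * (\<Prod>j\<leftarrow>js. g j))"
    using Cons assms by (intro mult_mono) (auto intro: order_trans[OF assms(1) assms(2)])
  then show ?case using Cons assms by (simp add: mult_ac)
qed simp

lemma positive_eigenvector_spectral_radius:
  fixes A :: "(real, 'n::finite) tensor" and x :: "real ^ 'n"
  assumes m: "m \<ge> 1"
    and nonneg: "\<And>is. length is = m \<Longrightarrow> A is \<ge> 0"
    and pos: "\<And>i. x $ i > 0" and l: "l \<ge> 0"
    and eig: "\<And>i. (\<Sum>js | length js = m - 1. A (i # js) * (\<Prod>j\<leftarrow>js. x $ j)) = l * x $ i ^ (m - 1)"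
  shows "tensor_spectral_radius m A = l"
  unfolding tensor_spectral_radius_def
proof (rule cSup_eq_maximum)
  define y :: "complex ^ 'n" where "y = (\<chi> i. of_real (x $ i))"
  have "y $ undefined \<noteq> 0" using pos[of undefined] by (simp add: y_def)
  then have "y \<noteq> 0" by auto
  moreover have "tensor_apply m (\<lambda>is. complex_of_real (A is)) y
      = (\<chi> i. complex_of_real l * vec_power y (m - 1) $ i)"
    using eig[THEN arg_cong[of _ _ complex_of_real]]
    by (simp add: tensor_apply_def vec_power_def y_def of_real_prod_list vec_eq_iff)
  moreover have "l = cmod (complex_of_real l)" using l by simp
  ultimately show "l \<in> {cmod \<mu> | \<mu> y. y \<noteq> 0 \<and>
      tensor_apply m (\<lambda>is. complex_of_real (A is)) y = (\<chi> i. \<mu> * vec_power y (m - 1) $ i)}"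
    by blast
next
  fix r assume "r \<in> {cmod \<mu> | \<mu> y. y \<noteq> 0 \<and>
      tensor_apply m (\<lambda>is. complex_of_real (A is)) y = (\<chi> i. \<mu> * vec_power y (m - 1) $ i)}"
  then obtain \<mu> and y :: "complex ^ 'n" where r: "r = cmod \<mu>" and y: "y \<noteq> 0"
    and e: "tensor_apply m (\<lambda>is. complex_of_real (A is)) y = (\<chi> i. \<mu> * vec_power y (m - 1) $ i)"
    by blast
  define q where "q i = cmod (y $ i) / x $ i" for i
  define t where "t = Max (range q)"
  have "t \<in> range q" unfolding t_def by (intro Max_in) auto
  then obtain i where i: "t = q i" by blast
  have qt: "q j \<le> t" for j unfolding t_def by (intro Max_ge) auto
  have yt: "cmod (y $ j) \<le> t * x $ j" for j
    using qt[of j] pos[of j] by (simp add: q_def divide_simps)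
  have yi: "cmod (y $ i) = t * x $ i" using pos[of i] by (simp add: i q_def)
  obtain k where "y $ k \<noteq> 0" using y by (auto simp: vec_eq_iff)
  then have "q k > 0" using pos[of k] by (simp add: q_def)
  then have tpos: "t > 0" using qt[of k] by linarith
  have "\<mu> * y $ i ^ (m - 1) = (\<Sum>js | length js = m - 1. of_real (A (i # js)) * (\<Prod>j\<leftarrow>js. y $ j))"
    using arg_cong[OF e, of "\<lambda>v. v $ i"] by (simp add: tensor_apply_def vec_power_def)
  then have "cmod \<mu> * cmod (y $ i) ^ (m - 1)
      = cmod (\<Sum>js | length js = m - 1. of_real (A (i # js)) * (\<Prod>j\<leftarrow>js. y $ j))"
    by (metis norm_mult norm_power)
  also have "\<dots> \<le> (\<Sum>js | length js = m - 1. A (i # js) * (t ^ (m - 1) * (\<Prod>j\<leftarrow>js. x $ j)))"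
  proof (rule sum_norm_le)
    fix js assume "js \<in> {js :: 'n list. length js = m - 1}"
    then have len: "length js = m - 1" by simp
    have "A (i # js) \<ge> 0" using len m by (intro nonneg) simp
    moreover have "(\<Prod>j\<leftarrow>js. cmod (y $ j)) \<le> t ^ (m - 1) * (\<Prod>j\<leftarrow>js. x $ j)"
      using prod_list_le_scaled[of "\<lambda>j. cmod (y $ j)" t "\<lambda>j. x $ j" js] yt len by simp
    ultimately show "cmod (of_real (A (i # js)) * (\<Prod>j\<leftarrow>js. y $ j))
        \<le> A (i # js) * (t ^ (m - 1) * (\<Prod>j\<leftarrow>js. x $ j))"
      by (simp add: norm_mult cmod_prod_list mult_left_mono)
  qed
  also have "\<dots> = t ^ (m - 1) * (l * x $ i ^ (m - 1))"
    unfolding eig[symmetric] sum_distrib_left by (simp add: mult_ac)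
  also have "\<dots> = l * cmod (y $ i) ^ (m - 1)"
    by (simp add: yi power_mult_distrib mult_ac)
  finally have "cmod \<mu> * cmod (y $ i) ^ (m - 1) \<le> l * cmod (y $ i) ^ (m - 1)" .
  moreover have "cmod (y $ i) ^ (m - 1) > 0" unfolding yi using tpos pos[of i] by simp
  ultimately show "r \<le> l" using r by (simp add: mult_le_cancel_right)
qed

lemma centrality_spectral_radius:
  fixes A :: "(dual, 'n::finite) tensor"
  assumes "m \<ge> 1"
    and "\<And>is. length is = m \<Longrightarrow> std (A is) = adjacency_tensor m E is"
    and c: "is_centrality_vector m A l x"
  shows "tensor_spectral_radius m (\<lambda>is. std (A is)) = std l"
proof (rule positive_eigenvector_spectral_radius)
  show "std (A is) \<ge> 0" if "length is = m" for "is"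
    using assms(2)[OF that] by (simp add: adjacency_tensor_def)
  show "vstd x $ i > 0" for i
    using c by (simp add: is_centrality_vector_def dual_vec_positive_def)
  show "std l \<ge> 0" using c by (simp add: is_centrality_vector_def dual_positive_def)
  have "tensor_apply m A x = (\<chi> i. l * vec_power x (m - 1) $ i)"
    using c by (simp add: is_centrality_vector_def dual_eigenpair_def)
  then have "std (tensor_apply m A x $ i) = std (l * x $ i ^ (m - 1))" for i
    by (simp add: vec_power_def)
  then show "(\<Sum>js | length js = m - 1. std (A (i # js)) * (\<Prod>j\<leftarrow>js. vstd x $ j))
      = std l * vstd x $ i ^ (m - 1)" for i
    by (simp add: tensor_apply_def std_sum std_prod_list std_power vstd_def)
qed (use assms in auto)

end

(* The dual part of the eigenvalue equation A x^(m-1) = l x^[m-1] is the linear system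
   M x_d = (A_d - l_d I) x_s^(m-1), and by Euler's identity its standard part gives M x_s = 0.
   Since M is a symmetric irreducible matrix with nonpositive off-diagonal entries and a positive
   null vector x_s, its kernel is spanned by x_s. Every {1}-inverse X therefore solves the system
   up to a multiple of x_s, which cancels in the difference of two entries at which x_s agrees. *)

theory Submission
  imports Defs "HOL-Combinatorics.Multiset_Permutations"
begin

section \<open>Dual parts of sums, powers and products\<close>

lemma dul_simps [simp]:
  "dul 0 = 0" "dul 1 = 0" "dul (a + b) = dul a + dul b"
  "dul (a * b) = std a * dul b + dul a * std b"
  by (simp_all add: zero_dual_def one_dual_def plus_dual_def times_dual_def)

lemma dul_sum: "dul (sum f S) = (\<Sum>i\<in>S. dul (f i))"
  by (induction S rule: infinite_finite_induct) auto

lemma std_prod: "std (prod f S) = (\<Prod>i\<in>S. std (f i))"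
  by (induction S rule: infinite_finite_induct) auto

text \<open>Since epsilon squares to zero, \<open>dul\<close> obeys the rules of differentiation
  over \<open>std\<close>; this is the power rule. For \<open>k = 0\<close> the truncated exponent
  is harmless, because the factor \<open>real k\<close> vanishes.\<close>

lemma dul_power: "dul (a ^ k) = real k * std a ^ (k - 1) * dul a"
proof (induction k)
  case (Suc k)
  then show ?case
    by (cases k) (simp_all add: std_power algebra_simps)
qed simp

text \<open>The Leibniz rule. Applied to an edge product it yields exactly the inner sum that
  reappears in \<open>centrality_matrix_mult_vec\<close>.\<close>

lemma dul_prod:
  assumes "finite S"
  shows "dul (prod f S) = (\<Sum>k\<in>S. dul (f k) * (\<Prod>i\<in>S - {k}. std (f i)))"
  using assms
proof (induction S)
  case (insert a S)
  have "(\<Prod>i\<in>insert a S - {k}. std (f i)) = std (f a) * (\<Prod>i\<in>S - {k}. std (f i))"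
    if "k \<in> S" for k
  proof -
    have "insert a S - {k} = insert a (S - {k})" using that insert.hyps by auto
    then show ?thesis using insert.hyps by simp
  qed
  moreover have "insert a S - {a} = S" using insert.hyps by auto
  ultimately show ?case
    using insert by (simp add: std_prod sum_distrib_left mult_ac)
qed simp

lemma of_nat_dual: "of_nat n = Dual (real n) 0"
  by (induction n) (simp_all add: zero_dual_def one_dual_def plus_dual_def)

section \<open>The adjacency tensor as a sum over edges\<close>

text \<open>An index list of length \<open>m\<close> whose set is an edge has no repetition, since
  the edge has \<open>m\<close> elements. So \<open>js\<close> is an ordering of
  \<open>e - {i}\<close>, and each edge through \<open>i\<close> is counted \<open>(m - 1)!\<close>
  times with the same product. The ring is left general so that dual entries are covered.\<close>

lemma sum_lists_over_edges:
  fixes x :: "'n::finite \<Rightarrow> 'a::comm_ring_1"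
  assumes m: "m \<ge> 1" and unif: "uniform_hypergraph m E"
  shows "(\<Sum>js | length js = m - 1. (if set (i # js) \<in> E then c else 0) * (\<Prod>j\<leftarrow>js. x j))
    = of_nat (fact (m - 1)) * c * (\<Sum>e | e \<in> E \<and> i \<in> e. \<Prod>k\<in>e - {i}. x k)"
proof -
  define F where "F = {e. e \<in> E \<and> i \<in> e}"
  have fin: "finite {js :: 'n list. length js = m - 1}"
    using finite_lists_length_eq[of "UNIV :: 'n set" "m - 1"] by simp
  have cardF: "card (e - {i}) = m - 1" if "e \<in> F" for e
    using that unif by (simp add: F_def uniform_hypergraph_def)
  have eq: "{js. length js = m - 1 \<and> set (i # js) \<in> E}
      = (\<Union>e\<in>F. permutations_of_set (e - {i}))"
  proof (intro equalityI subsetI)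
    fix js assume "js \<in> {js. length js = m - 1 \<and> set (i # js) \<in> E}"
    then have len: "length js = m - 1" and e: "set (i # js) \<in> E" by auto
    from e have "card (set (i # js)) = length (i # js)"
      using unif len m by (simp add: uniform_hypergraph_def)
    then have "distinct (i # js)" by (rule card_distinct)
    then have "js \<in> permutations_of_set (set (i # js) - {i})"
      by (auto simp: permutations_of_set_def)
    moreover have "set (i # js) \<in> F" using e by (simp add: F_def)
    ultimately show "js \<in> (\<Union>e\<in>F. permutations_of_set (e - {i}))" by blast
  next
    fix js assume "js \<in> (\<Union>e\<in>F. permutations_of_set (e - {i}))"
    then obtain e where e: "e \<in> F" and js: "set js = e - {i}" "distinct js"
      by (auto simp: permutations_of_set_def)
    have "length js = m - 1" using js cardF[OF e] distinct_card by fastforce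
    moreover have "set (i # js) = e" using js e by (auto simp: F_def)
    ultimately show "js \<in> {js. length js = m - 1 \<and> set (i # js) \<in> E}"
      using e by (simp add: F_def)
  qed
  have "(\<Sum>js | length js = m - 1. (if set (i # js) \<in> E then c else 0) * (\<Prod>j\<leftarrow>js. x j))
      = (\<Sum>js | length js = m - 1 \<and> set (i # js) \<in> E. c * (\<Prod>j\<leftarrow>js. x j))"
    by (intro sum.mono_neutral_cong_right fin) auto
  also have "\<dots> = (\<Sum>e\<in>F. \<Sum>js\<in>permutations_of_set (e - {i}). c * (\<Prod>j\<leftarrow>js. x j))"
    unfolding eq
  proof (rule sum.UNION_disjoint)
    \<comment> \<open>All members of \<open>F\<close> contain \<open>i\<close>, so
      \<open>e - {i}\<close> determines \<open>e\<close>.\<close>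
    show "\<forall>e\<in>F. \<forall>e'\<in>F. e \<noteq> e' \<longrightarrow>
        permutations_of_set (e - {i}) \<inter> permutations_of_set (e' - {i}) = {}"
      by (auto simp: permutations_of_set_def F_def)
  qed auto
  also have "\<dots> = (\<Sum>e\<in>F. of_nat (fact (m - 1)) * c * (\<Prod>k\<in>e - {i}. x k))"
  proof (rule sum.cong[OF refl])
    fix e assume e: "e \<in> F"
    have "(\<Sum>js\<in>permutations_of_set (e - {i}). c * (\<Prod>j\<leftarrow>js. x j))
        = (\<Sum>js\<in>permutations_of_set (e - {i}). c * (\<Prod>k\<in>e - {i}. x k))"
      by (intro sum.cong refl)
        (metis permutations_of_setD prod.distinct_set_conv_list)
    also have "\<dots> = of_nat (fact (m - 1)) * c * (\<Prod>k\<in>e - {i}. x k)"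
      using cardF[OF e] by (simp add: mult_ac)
    finally show "(\<Sum>js\<in>permutations_of_set (e - {i}). c * (\<Prod>j\<leftarrow>js. x j))
        = of_nat (fact (m - 1)) * c * (\<Prod>k\<in>e - {i}. x k)" .
  qed
  finally show ?thesis by (simp add: F_def sum_distrib_left)
qed

text \<open>Each entry splits into its standard part and a purely dual part. A purely dual factor
  sees only the standard part of what it multiplies, so \<open>x\<close> enters the second summand
  through \<open>vstd x\<close> alone.\<close>

lemma tensor_apply_dual_adjacency:
  fixes A :: "(dual, 'n::finite) tensor"
  assumes m: "m \<ge> 1" and unif: "uniform_hypergraph m E"
    and adj: "\<And>is. length is = m \<Longrightarrow> std (A is) = adjacency_tensor m E is"
  shows "tensor_apply m A x $ i = (\<Sum>e | e \<in> E \<and> i \<in> e. \<Prod>k\<in>e - {i}. x $ k)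
    + Dual 0 (tensor_apply m (\<lambda>is. dul (A is)) (vstd x) $ i)"
proof -
  define c where "c = Dual (1 / fact (m - 1)) 0"
  have A: "A (i # js) = (if set (i # js) \<in> E then c else 0) + Dual 0 (dul (A (i # js)))"
    if "length js = m - 1" for js
    using adj[of "i # js"] that m
    by (cases "A (i # js)") (auto simp: adjacency_tensor_def c_def plus_dual_def zero_dual_def)
  have Dual_sum: "(\<Sum>k\<in>S. Dual 0 (g k)) = Dual 0 (sum g S)" for g and S :: "'n list set"
    by (induction S rule: infinite_finite_induct) (auto simp: zero_dual_def plus_dual_def)
  have "tensor_apply m A x $ i
      = (\<Sum>js | length js = m - 1. (if set (i # js) \<in> E then c else 0) * (\<Prod>j\<leftarrow>js. x $ j)
          + Dual 0 (dul (A (i # js)) * (\<Prod>j\<leftarrow>js. vstd x $ j)))"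
    unfolding tensor_apply_def vec_lambda_beta
  proof (rule sum.cong[OF refl])
    fix js assume "js \<in> {js :: 'n list. length js = m - 1}"
    then have "A (i # js) * (\<Prod>j\<leftarrow>js. x $ j)
        = ((if set (i # js) \<in> E then c else 0) + Dual 0 (dul (A (i # js)))) * (\<Prod>j\<leftarrow>js. x $ j)"
      using A[of js] by simp
    also have "\<dots> = (if set (i # js) \<in> E then c else 0) * (\<Prod>j\<leftarrow>js. x $ j)
        + Dual 0 (dul (A (i # js))) * (\<Prod>j\<leftarrow>js. x $ j)"
      by (rule distrib_right)
    also have "Dual 0 (dul (A (i # js))) * (\<Prod>j\<leftarrow>js. x $ j)
        = Dual 0 (dul (A (i # js)) * (\<Prod>j\<leftarrow>js. vstd x $ j))"
      by (simp add: times_dual_def std_prod_list vstd_def)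
    finally show "A (i # js) * (\<Prod>j\<leftarrow>js. x $ j)
        = (if set (i # js) \<in> E then c else 0) * (\<Prod>j\<leftarrow>js. x $ j)
          + Dual 0 (dul (A (i # js)) * (\<Prod>j\<leftarrow>js. vstd x $ j))" .
  qed
  also have "\<dots> = of_nat (fact (m - 1)) * c * (\<Sum>e | e \<in> E \<and> i \<in> e. \<Prod>k\<in>e - {i}. x $ k)
      + Dual 0 (tensor_apply m (\<lambda>is. dul (A is)) (vstd x) $ i)"
    unfolding sum.distrib Dual_sum sum_lists_over_edges[OF m unif]
    by (simp add: tensor_apply_def)
  also have "of_nat (fact (m - 1)) * c = 1"
    by (simp only: of_nat_dual c_def) (simp add: times_dual_def one_dual_def)
  finally show ?thesis by simp
qed

section \<open>The centrality matrix as a linear map\<close>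

text \<open>Interchanging the sums over vertices and edges turns the off-diagonal part of row
  \<open>u\<close> into minus the derivative, at \<open>y\<close> in direction \<open>z\<close>, of
  the sum of edge products through \<open>u\<close>.\<close>

lemma centrality_matrix_mult_vec:
  fixes E :: "'n::finite set set"
  shows "(centrality_matrix m E r y *v z) $ u
    = real (m - 1) * r * y $ u ^ (m - 2) * z $ u
      - (\<Sum>e | e \<in> E \<and> u \<in> e. \<Sum>v\<in>e - {u}. z $ v * (\<Prod>k\<in>e - {u} - {v}. y $ k))"
proof -
  let ?M = "centrality_matrix m E r y"
  let ?t = "\<lambda>e v. z $ v * (\<Prod>k\<in>e - {u} - {v}. y $ k)"
  have off: "?M $ u $ v * z $ v = - (\<Sum>e | e \<in> E \<and> u \<in> e. if v \<in> e - {u} then ?t e v else 0)"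
    if "v \<noteq> u" for v
  proof -
    \<comment> \<open>For non-adjacent vertices the edge sum is empty, so one formula serves both
      off-diagonal cases.\<close>
    have "?M $ u $ v = - (\<Sum>e | e \<in> E \<and> {u, v} \<subseteq> e. \<Prod>k\<in>e - {u, v}. y $ k)"
    proof (cases "hyper_adj E u v")
      case False
      then have "{e. e \<in> E \<and> {u, v} \<subseteq> e} = {}" using that by (auto simp: hyper_adj_def)
      then have "(\<Sum>e | e \<in> E \<and> {u, v} \<subseteq> e. \<Prod>k\<in>e - {u, v}. y $ k) = 0"
        by (simp only: sum.empty)
      with False show ?thesis using that by (simp add: centrality_matrix_def)
    qed (use that in \<open>simp add: centrality_matrix_def\<close>)
    then have "?M $ u $ v * z $ v
        = - (\<Sum>e | e \<in> E \<and> {u, v} \<subseteq> e. z $ v * (\<Prod>k\<in>e - {u, v}. y $ k))"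
      by (simp add: sum_distrib_left mult.commute)
    also have "(\<Sum>e | e \<in> E \<and> {u, v} \<subseteq> e. z $ v * (\<Prod>k\<in>e - {u, v}. y $ k))
        = (\<Sum>e | e \<in> E \<and> u \<in> e. if v \<in> e - {u} then ?t e v else 0)"
      by (rule sum.mono_neutral_cong_left) (use that in \<open>auto simp: Diff_insert2[of _ u "{v}"]\<close>)
    finally show ?thesis .
  qed
  have "(?M *v z) $ u = ?M $ u $ u * z $ u + (\<Sum>v\<in>UNIV - {u}. ?M $ u $ v * z $ v)"
    by (simp add: matrix_vector_mult_def sum.remove[of UNIV u])
  also have "(\<Sum>v\<in>UNIV - {u}. ?M $ u $ v * z $ v)
      = - (\<Sum>v\<in>UNIV - {u}. \<Sum>e | e \<in> E \<and> u \<in> e. if v \<in> e - {u} then ?t e v else 0)"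
    unfolding sum_negf[of _ "UNIV - {u}", symmetric] by (intro sum.cong refl off) simp
  also have "(\<Sum>v\<in>UNIV - {u}. \<Sum>e | e \<in> E \<and> u \<in> e. if v \<in> e - {u} then ?t e v else 0)
      = (\<Sum>e | e \<in> E \<and> u \<in> e. \<Sum>v\<in>UNIV - {u}. if v \<in> e - {u} then ?t e v else 0)"
    by (rule sum.swap)
  also have "\<dots> = (\<Sum>e | e \<in> E \<and> u \<in> e. \<Sum>v\<in>e - {u}. ?t e v)"
    by (intro sum.cong refl sum.mono_neutral_cong_right) auto
  finally show ?thesis by (simp add: centrality_matrix_def)
qed

text \<open>Euler's identity for polynomials homogeneous of degree \<open>m - 1\<close>: for
  \<open>z = y\<close> each of the \<open>m - 1\<close> vertices of \<open>e - {u}\<close> restores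
  the full product, so the edge sum is \<open>m - 1\<close> times the left side of
  \<open>eig\<close> and cancels the diagonal term.\<close>

lemma centrality_matrix_null_vector:
  fixes E :: "'n::finite set set"
  assumes m: "m \<ge> 2" and unif: "uniform_hypergraph m E"
    and eig: "\<And>u. (\<Sum>e | e \<in> E \<and> u \<in> e. \<Prod>k\<in>e - {u}. y $ k) = r * y $ u ^ (m - 1)"
  shows "centrality_matrix m E r y *v y = 0"
proof -
  have "(centrality_matrix m E r y *v y) $ u = 0" for u
  proof -
    have "(\<Sum>e | e \<in> E \<and> u \<in> e. \<Sum>v\<in>e - {u}. y $ v * (\<Prod>k\<in>e - {u} - {v}. y $ k))
        = (\<Sum>e | e \<in> E \<and> u \<in> e. real (m - 1) * (\<Prod>k\<in>e - {u}. y $ k))"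
    proof (rule sum.cong[OF refl])
      fix e assume "e \<in> {e. e \<in> E \<and> u \<in> e}"
      then have "card (e - {u}) = m - 1" using unif by (simp add: uniform_hypergraph_def)
      then show "(\<Sum>v\<in>e - {u}. y $ v * (\<Prod>k\<in>e - {u} - {v}. y $ k))
          = real (m - 1) * (\<Prod>k\<in>e - {u}. y $ k)"
        by (simp add: prod.remove[symmetric])
    qed
    also have "\<dots> = real (m - 1) * (r * y $ u ^ (m - 1))"
      by (simp add: sum_distrib_left[symmetric] eig)
    \<comment> \<open>With truncated subtraction this needs \<open>m \<ge> 2\<close>; at
      \<open>m = 1\<close> both exponents would be zero.\<close>
    also have "y $ u ^ (m - 1) = y $ u ^ (m - 2) * y $ u"
      using m by (metis Suc_1 Suc_diff_le diff_Suc_Suc power_Suc2)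
    finally show ?thesis by (simp add: centrality_matrix_mult_vec)
  qed
  then show ?thesis by (simp add: vec_eq_iff)
qed

lemma transpose_centrality_matrix:
  "transpose (centrality_matrix m E r y) = centrality_matrix m E r y"
  by (auto simp: transpose_def centrality_matrix_def vec_eq_iff hyper_adj_def insert_commute)

text \<open>The strict sign on adjacent pairs is what turns connectedness of the hypergraph into
  irreducibility of the matrix.\<close>

lemma centrality_matrix_off_diagonal:
  fixes E :: "'n::finite set set"
  assumes "\<And>k. y $ k > 0" "u \<noteq> v"
  shows "centrality_matrix m E r y $ u $ v \<le> 0"
    and "hyper_adj E u v \<Longrightarrow> centrality_matrix m E r y $ u $ v < 0"
proof -
  have "(\<Sum>e | e \<in> E \<and> {u, v} \<subseteq> e. \<Prod>k\<in>e - {u, v}. y $ k) > 0" if "hyper_adj E u v"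
    using that assms(1) by (intro sum_pos prod_pos) (auto simp: hyper_adj_def)
  then show "hyper_adj E u v \<Longrightarrow> centrality_matrix m E r y $ u $ v < 0"
    using assms(2) by (simp add: centrality_matrix_def)
  then show "centrality_matrix m E r y $ u $ v \<le> 0"
    using assms(2) by (cases "hyper_adj E u v") (auto simp: centrality_matrix_def)
qed

section \<open>Singular symmetric irreducible matrices\<close>

text \<open>A maximum principle. With \<open>t\<close> the largest ratio
  \<open>z $ v / y $ v\<close>, the kernel vector \<open>w = t y - z\<close> is nonnegative and
  vanishes at a maximising index; its zeros spread along negative entries of \<open>M\<close> to
  every index.\<close>

lemma irreducible_Z_matrix_kernel:
  fixes M :: "real ^ 'n ^ 'n"
  assumes off: "\<And>u v. u \<noteq> v \<Longrightarrow> M $ u $ v \<le> 0"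
    and conn: "\<And>u v. (\<lambda>u v. u \<noteq> v \<and> M $ u $ v < 0)\<^sup>*\<^sup>* u v"
    and pos: "\<And>k. y $ k > 0" and y: "M *v y = 0" and z: "M *v z = 0"
  shows "\<exists>c. z = c *\<^sub>R y"
proof -
  define q where "q v = z $ v / y $ v" for v
  define t where "t = Max (range q)"
  define w where "w = t *\<^sub>R y - z"
  have "t \<in> range q" unfolding t_def by (intro Max_in) auto
  then obtain u0 where u0: "t = q u0" by blast
  have "q v \<le> t" for v unfolding t_def by (intro Max_ge) auto
  then have w0: "w $ v \<ge> 0" for v
    using pos[of v] by (simp add: w_def q_def divide_simps)
  have Mw: "M *v w = 0"
    by (simp add: w_def y z matrix_vector_mult_diff_distrib matrix_vector_mult_scaleR)
  have step: "w $ v = 0" if "w $ u = 0" "u \<noteq> v" "M $ u $ v < 0" for u v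
  proof -
    have "(\<Sum>k\<in>UNIV. - (M $ u $ k * w $ k)) = 0"
      using arg_cong[OF Mw, of "\<lambda>a. a $ u"] by (simp add: matrix_vector_mult_def sum_negf)
    \<comment> \<open>The diagonal entry has no prescribed sign, but its term vanishes because
      \<open>w $ u = 0\<close>. A zero sum of nonnegative terms then forces each term to be
      zero.\<close>
    moreover have "- (M $ u $ k * w $ k) \<ge> 0" for k
      using off[of u k] w0[of k] that(1) by (cases "k = u") (auto simp: mult_nonpos_nonneg)
    ultimately have "- (M $ u $ v * w $ v) = 0"
      by (subst (asm) sum_nonneg_eq_0_iff) auto
    then show ?thesis using that(3) by simp
  qed
  have "w $ v = 0" for v
    using conn[of u0 v]
  proof (induction rule: rtranclp_induct)
    case base
    show ?case using pos[of u0] by (simp add: w_def u0 q_def)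
  qed (use step in blast)
  then have "w = 0" by (simp add: vec_eq_iff)
  then show ?thesis by (auto simp: w_def)
qed

text \<open>\<open>group_inverse\<close> is a definite description, so its defining equations become
  available only once some group inverse is exhibited.\<close>

lemma symmetric_corank_one_group_inverse:
  fixes M :: "real ^ 'n ^ 'n"
  assumes sym: "transpose M = M" and y: "M *v y = 0" "y \<noteq> 0"
    and ker: "\<And>z. M *v z = 0 \<Longrightarrow> \<exists>c. z = c *\<^sub>R y"
  shows "is_group_inverse M (group_inverse M)"
proof -
  \<comment> \<open>P is the orthogonal projection onto the kernel, and M + P is invertible with
    inverse Y; then Y - P is the group inverse.\<close>
  define P :: "real ^ 'n ^ 'n" where "P = (\<chi> u v. y $ u * y $ v / (y \<bullet> y))"
  have yy: "y \<bullet> y \<noteq> 0" using y by simp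
  have Pv: "P *v z = ((y \<bullet> z) / (y \<bullet> y)) *\<^sub>R y" for z
    by (simp add: P_def matrix_vector_mult_def vec_eq_iff inner_vec_def sum_distrib_left
        sum_divide_distrib mult_ac)
  \<comment> \<open>By symmetry \<open>M\<close> can be moved onto \<open>y\<close>, so the range of
    \<open>M\<close> is orthogonal to its kernel.\<close>
  have yM: "y \<bullet> (M *v z) = 0" for z
    using y sym by (metis dot_lmul_matrix inner_zero_left matrix_vector_mul_assoc
        transpose_matrix_vector)
  have PM: "P ** M = 0" and MP: "M ** P = 0" and PP: "P ** P = P"
    by (rule matrix_eq[THEN iffD2],
        simp add: matrix_vector_mul_assoc[symmetric] Pv yM y yy matrix_vector_mult_scaleR)+
  \<comment> \<open>Pairing with \<open>y\<close> removes \<open>M *v z\<close> and leaves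
    \<open>z\<close> orthogonal to \<open>y\<close>; then \<open>z\<close> lies in the kernel as
    well, hence is zero.\<close>
  have "z = 0" if "(M + P) *v z = 0" for z
  proof -
    have e: "M *v z + P *v z = 0" using that by (simp add: matrix_vector_mult_add_rdistrib)
    then have "y \<bullet> (M *v z + P *v z) = 0" by simp
    then have yz: "y \<bullet> z = 0" using yy by (simp add: inner_add_right yM Pv)
    then have "M *v z = 0" using e by (simp add: Pv)
    then obtain c where "z = c *\<^sub>R y" using ker by blast
    then show ?thesis using yz yy by simp
  qed
  then obtain Y where YL: "Y ** (M + P) = mat 1"
    using matrix_left_invertible_ker[of "M + P"] by blast
  then have YR: "(M + P) ** Y = mat 1" by (simp add: matrix_left_right_inverse)
  have ladd: "B ** (C + D) = B ** C + B ** D" and radd: "(C + D) ** B = C ** B + D ** B"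
    and ldiff: "B ** (C - D) = B ** C - B ** D" and rdiff: "(C - D) ** B = C ** B - D ** B"
    for B C D :: "real ^ 'n ^ 'n"
    by (simp_all add: matrix_matrix_mult_def vec_eq_iff algebra_simps sum.distrib sum_subtractf)
  have YP: "Y ** P = P"
  proof -
    have "Y ** P = Y ** ((M + P) ** P)" by (simp add: radd MP PP)
    then show ?thesis by (simp add: matrix_mul_assoc YL)
  qed
  have PY: "P ** Y = P"
  proof -
    have "P ** Y = (P ** (M + P)) ** Y" by (simp add: ladd PM PP)
    then show ?thesis by (simp add: matrix_mul_assoc[symmetric] YR)
  qed
  have MY: "M ** Y = mat 1 - P"
    using YR by (simp add: radd PY eq_diff_eq)
  have YM: "Y ** M = mat 1 - P"
    using YL by (simp add: ladd YP eq_diff_eq)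
  have "is_group_inverse M (Y - P)"
    by (simp add: is_group_inverse_def ldiff rdiff MY YM PM MP PP PY YP)
  then show ?thesis using group_inverse_eqI by metis
qed

theorem theorem4p2:
  fixes m :: nat and E :: "'n::finite set set"
    and A :: "(dual, 'n) tensor" and x :: "dual ^ 'n" and l :: dual and i j :: 'n
  assumes "m \<ge> 2"
    and "uniform_hypergraph m E" and "hyper_connected E" and "E \<noteq> {}"
    and "\<And>is. length is = m \<Longrightarrow> std (A is) = adjacency_tensor m E is"
    and "is_centrality_vector m A l x"
    and "vstd x $ i = vstd x $ j"
  defines "M \<equiv> centrality_matrix m E (std l) (vstd x)"
    and "b \<equiv> tensor_apply m (\<lambda>is. dul (A is) - dul l * unit_tensor m is) (vstd x)"
  shows "vdul x $ i - vdul x $ j = (axis i 1 - axis j 1) \<bullet> (group_inverse M *v b) \<and>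
    (\<forall>X. is_one_inverse M X \<longrightarrow>
      (axis i 1 - axis j 1) \<bullet> (group_inverse M *v b) = (axis i 1 - axis j 1) \<bullet> (X *v b))"
proof -
  have m1: "m \<ge> 1" using assms(1) by simp
  have pos: "vstd x $ k > 0" for k
    using assms(6) by (simp add: is_centrality_vector_def dual_vec_positive_def)
  have "tensor_apply m A x $ u = l * x $ u ^ (m - 1)" for u
    using assms(6) by (simp add: is_centrality_vector_def dual_eigenpair_def vec_power_def)
  then have eig: "(\<Sum>e | e \<in> E \<and> u \<in> e. \<Prod>k\<in>e - {u}. x $ k)
      + Dual 0 (tensor_apply m (\<lambda>is. dul (A is)) (vstd x) $ u) = l * x $ u ^ (m - 1)" for u
    using tensor_apply_dual_adjacency[OF m1 assms(2,5), of x u] by simp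
  have eig_std: "(\<Sum>e | e \<in> E \<and> u \<in> e. \<Prod>k\<in>e - {u}. vstd x $ k)
      = std l * vstd x $ u ^ (m - 1)" for u
    using arg_cong[OF eig[of u], of std] by (simp add: std_sum std_prod std_power vstd_def)
  \<comment> \<open>The left sum comes from \<open>dul_prod\<close>, the factor
    \<open>real (m - 1)\<close> with exponent \<open>m - 2\<close> from \<open>dul_power\<close> at
    \<open>m - 1\<close>. Moving the edge sum to the right produces row \<open>u\<close> of
    \<open>M *v vdul x\<close>.\<close>
  have eig_dul: "(\<Sum>e | e \<in> E \<and> u \<in> e. \<Sum>v\<in>e - {u}.
        vdul x $ v * (\<Prod>k\<in>e - {u} - {v}. vstd x $ k))
      + tensor_apply m (\<lambda>is. dul (A is)) (vstd x) $ u
      = real (m - 1) * std l * vstd x $ u ^ (m - 2) * vdul x $ u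
        + dul l * vstd x $ u ^ (m - 1)" for u
    using arg_cong[OF eig[of u], of dul]
    by (simp add: dul_sum dul_prod dul_power std_power vstd_def vdul_def mult_ac numeral_2_eq_2)
  have "tensor_apply m (\<lambda>is. dul l * unit_tensor m is) (vstd x) $ u
      = dul l * tensor_apply m (unit_tensor m) (vstd x) $ u" for u
    by (simp add: tensor_apply_def sum_distrib_left mult_ac)
  then have "b $ u = tensor_apply m (\<lambda>is. dul (A is)) (vstd x) $ u
      - dul l * vstd x $ u ^ (m - 1)" for u
    unfolding unit_tensor_apply[OF m1] b_def
    by (simp add: tensor_apply_def vec_power_def left_diff_distrib sum_subtractf)
  then have "b $ u = (M *v vdul x) $ u" for u
    using eig_dul[of u] unfolding M_def centrality_matrix_mult_vec by simp
  then have b: "b = M *v vdul x" by (simp add: vec_eq_iff)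
  have null: "M *v vstd x = 0"
    unfolding M_def by (rule centrality_matrix_null_vector[OF assms(1,2) eig_std])
  have off: "M $ u $ v \<le> 0" if "u \<noteq> v" for u v
    unfolding M_def by (rule centrality_matrix_off_diagonal(1)[OF pos that])
  have conn: "(\<lambda>u v. u \<noteq> v \<and> M $ u $ v < 0)\<^sup>*\<^sup>* u v" for u v
  proof -
    have "(hyper_adj E)\<^sup>*\<^sup>* u v" using assms(3) by (simp add: hyper_connected_def)
    then show ?thesis
    proof (rule rtranclp_mono[THEN predicate2D, rotated], intro predicate2I conjI)
      fix u v assume uv: "hyper_adj E u v"
      then show "u \<noteq> v" by (simp add: hyper_adj_def)
      then show "M $ u $ v < 0"
        unfolding M_def using uv by (rule centrality_matrix_off_diagonal(2)[OF pos])
    qed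
  qed
  have ker: "\<exists>c. z = c *\<^sub>R vstd x" if "M *v z = 0" for z
    using irreducible_Z_matrix_kernel[OF off conn pos null that] .
  have one: "(axis i 1 - axis j 1) \<bullet> (X *v b) = vdul x $ i - vdul x $ j"
    if "is_one_inverse M X" for X
  proof -
    \<comment> \<open>As \<open>b\<close> lies in the range of \<open>M\<close>, the identity
      \<open>M ** X ** M = M\<close> makes \<open>X *v b\<close> a solution of the same system as
      \<open>vdul x\<close>.\<close>
    have "M *v (X *v b - vdul x) = 0"
      using that by (simp add: is_one_inverse_def b matrix_vector_mult_diff_distrib
          matrix_vector_mul_assoc matrix_mul_assoc)
    then obtain c where "X *v b - vdul x = c *\<^sub>R vstd x" using ker by blast
    then have X: "X *v b = vdul x + c *\<^sub>R vstd x" by (simp add: algebra_simps)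
    show ?thesis unfolding X using assms(7) by (simp add: inner_diff_left inner_axis')
  qed
  have "vstd x \<noteq> 0" using pos[of i] by auto
  then have "is_group_inverse M (group_inverse M)"
    using null ker unfolding M_def
    by (intro symmetric_corank_one_group_inverse[OF transpose_centrality_matrix])
  \<comment> \<open>The group inverse is itself a {1}-inverse, so \<open>one\<close> evaluates both
    expressions to the same difference.\<close>
  then have "is_one_inverse M (group_inverse M)"
    unfolding is_group_inverse_def is_one_inverse_def by (rule conjunct1)
  then show ?thesis using one by simp
qed

end
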